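(* Let $N\geq 3$ and let $h=(x_1,\dots,x_N)$ and $h'=(x_1',\dots,x_N')$ be elements of $\mathbb{R}^N$ with $(x_1,x_2)\neq(0,0)$ and $(x_1',x_2')\neq(0,0)$. Let $h''=(x_1'',\dots,x_N'')$ be the Cartesian coordinates of the hyperspherical hypercomplex product $h\cdot h'$. Put $r_1=x_1$, $r_1'=x_1'$ and, for $2\le n\le N$, $r_n=\sqrt{\sum_{k=1}^n x_k^2}$ and $r_n'=\sqrt{\sum_{k=1}^n x_k'^2}$. Then $$x_1''=(x_1x_1'-x_2x_2')\prod_{n=3}^{N}\left(1-\frac{x_nx_n'}{r_{n-1}r_{n-1}'}\right),$$ and, for every $2\le k\le N$, $$x_k''=(x_kr_{k-1}'+x_k'r_{k-1})\prod_{n=k+1}^{N}\left(1-\frac{x_nx_n'}{r_{n-1}r_{n-1}'}\right),$$ where an empty product equals $1$; in particular $x_2''=(x_1x_2'+x_2x_1')\prod_{n=3}^{N}\left(1-\frac{x_nx_n'}{r_{n-1}r_{n-1}'}\right)$ and $x_N''=x_Nr_{N-1}'+x_N'r_{N-1}$.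
   Context: Hyperspherical coordinates: a tuple $(r,\theta_2,\dots,\theta_N)$ with $r\ge 0$ and real arguments $\theta_2,\dots,\theta_N$ represents the point of $\mathbb{R}^N$ with Cartesian coordinates $$x_1=r\prod_{n=2}^N\cos\theta_n,\qquad x_k=r\sin\theta_k\prod_{n=k+1}^N\cos\theta_n\quad(2\le k\le N).$$ For a point $h\in\mathbb{R}^N$ with $(x_1,x_2)\ne(0,0)$ one uses $r=\sqrt{\sum_{k=1}^N x_k^2}$, the longitude $\theta_2\in[0,2\pi)$, and the latitudes $\theta_k\in\left[-\frac{\pi}{2},\frac{\pi}{2}\right]$ for $3\le k\le N$ (so $\tan\theta_k=x_k/\sqrt{x_1^2+\dots+x_{k-1}^2}$ for $k\ge 3$, and $\cos\theta_2=x_1/\sqrt{x_1^2+x_2^2}$, $\sin\theta_2=x_2/\sqrt{x_1^2+x_2^2}$); these are uniquely determined by $h$. If $h$ and $h'$ have hyperspherical coordinates $(r,\theta_2,\dots,\theta_N)$ and $(r',\theta_2',\dots,\theta_N')$ chosen in this way, the hyperspherical hypercomplex product $h\cdot h'$ is the point represented by $(rr',\theta_2+\theta_2',\dots,\theta_N+\theta_N')$. *)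

theory Defs
  imports Complex_Main "HOL-Library.FuncSet"
begin

text \<open>
  \<open>\<real>\<^sup>N\<close> is the set \<open>{1..N} \<rightarrow>\<^sub>E UNIV\<close> of coordinate functions on \<open>{1..N}\<close> (undefined elsewhere, so that
  equality of functions is equality of points). Angle tuples \<open>(\<theta>\<^sub>2, \<dots>, \<theta>\<^sub>N)\<close> are functions on
  \<open>{2..N}\<close>.
\<close>

definition hs_point :: "nat \<Rightarrow> real \<Rightarrow> (nat \<Rightarrow> real) \<Rightarrow> nat \<Rightarrow> real" where
  "hs_point N r \<theta> = (\<lambda>k\<in>{1..N}.
     if k = 1 then r * (\<Prod>n=2..N. cos (\<theta> n))
     else r * sin (\<theta> k) * (\<Prod>n=k+1..N. cos (\<theta> n)))"

definition is_hs_coords :: "nat \<Rightarrow> (nat \<Rightarrow> real) \<Rightarrow> real \<times> (nat \<Rightarrow> real) \<Rightarrow> bool" where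
  "is_hs_coords N x = (\<lambda>(r, \<theta>).
     \<theta> \<in> {2..N} \<rightarrow>\<^sub>E UNIV \<and>
     r = sqrt (\<Sum>k=1..N. (x k)\<^sup>2) \<and>
     0 \<le> \<theta> 2 \<and> \<theta> 2 < 2 * pi \<and>
     (\<forall>k\<in>{3..N}. - (pi / 2) \<le> \<theta> k \<and> \<theta> k \<le> pi / 2) \<and>
     hs_point N r \<theta> = x)"

text \<open>
  For \<open>N \<ge> 2\<close> and \<open>(x\<^sub>1, x\<^sub>2) \<noteq> (0, 0)\<close> exactly one such tuple exists; for other points the
  value is irrelevant.
\<close>

definition hs_coords :: "nat \<Rightarrow> (nat \<Rightarrow> real) \<Rightarrow> real \<times> (nat \<Rightarrow> real)" where
  "hs_coords N x = (THE c. is_hs_coords N x c)"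

definition hs_mult :: "nat \<Rightarrow> (nat \<Rightarrow> real) \<Rightarrow> (nat \<Rightarrow> real) \<Rightarrow> nat \<Rightarrow> real" where
  "hs_mult N x x' =
     (let (r, \<theta>) = hs_coords N x; (r', \<theta>') = hs_coords N x'
      in hs_point N (r * r') (\<lambda>n. \<theta> n + \<theta>' n))"

end

(* Let r_k be the norm of the first k coordinates, except that r_1 = x_1 keeps its sign. The tuple
   (r, theta) represents x exactly when r = r_N, x_k = r_k sin theta_k and
   r_(k-1) = r_k cos theta_k for 2 <= k <= N. The product formulas are then the addition theorems:
   r_k r'_k sin (theta_k + theta'_k) = x_k r'_(k-1) + x'_k r_(k-1), and
   r_n r'_n cos (theta_n + theta'_n) = r_(n-1) r'_(n-1) - x_n x'_n, in which r_(n-1) r'_(n-1) can be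
   factored out for n >= 3, so that the product telescopes. *)
theory Submission imports Defs begin

section \<open>Signed partial norms\<close>

text \<open>The first partial norm is signed, so that \<^prop>\<open>partial_norm x (k - 1) = partial_norm x k * cos (\<theta> k)\<close>
  also holds for \<^prop>\<open>k = 2\<close>, where the longitude ranges over the full circle.\<close>

definition partial_norm :: "(nat \<Rightarrow> real) \<Rightarrow> nat \<Rightarrow> real" where
  "partial_norm x n = (if n = 1 then x 1 else sqrt (\<Sum>k=1..n. (x k)\<^sup>2))"

lemma partial_norm_1 [simp]: "partial_norm x (Suc 0) = x (Suc 0)"
  by (simp add: partial_norm_def)

lemma partial_norm_ge_2: "2 \<le> n \<Longrightarrow> partial_norm x n = sqrt (\<Sum>k=1..n. (x k)\<^sup>2)"
  by (simp add: partial_norm_def)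

text \<open>Squaring removes the sign of the first partial norm, so the case \<open>n = 1\<close>
  needs no separate treatment.\<close>

lemma partial_norm_square: "1 \<le> n \<Longrightarrow> (partial_norm x n)\<^sup>2 = (\<Sum>k=1..n. (x k)\<^sup>2)"
  by (auto simp: partial_norm_def sum_nonneg)

lemma partial_norm_square_pred:
  assumes "2 \<le> n"
  shows "(partial_norm x n)\<^sup>2 = (partial_norm x (n - 1))\<^sup>2 + (x n)\<^sup>2"
proof -
  obtain m where "n = Suc m" "1 \<le> m"
    using assms by (cases n) auto
  then show ?thesis
    by (simp add: partial_norm_square del: One_nat_def)
qed

text \<open>The first two squares already have a positive sum. At \<open>n = 1\<close> positivity
  may fail, since the value there is \<open>x 1\<close>.\<close>

lemma partial_norm_pos:
  assumes "(x 1, x 2) \<noteq> (0, 0)" "2 \<le> n"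
  shows "0 < partial_norm x n"
proof -
  have "0 < (\<Sum>k\<in>{1, 2}. (x k)\<^sup>2)"
    using assms(1) by (auto simp: sum_power2_gt_zero_iff)
  also have "\<dots> \<le> (\<Sum>k=1..n. (x k)\<^sup>2)"
    using assms(2) by (intro sum_mono2) auto
  finally show ?thesis
    using assms(2) by (simp add: partial_norm_ge_2)
qed

section \<open>Telescoping products\<close>

lemma prod_atLeastAtMost_pred:
  fixes f :: "nat \<Rightarrow> 'a::comm_monoid_mult"
  assumes "1 \<le> k" "k \<le> N"
  shows "(\<Prod>n=k..N. f n) = f k * (\<Prod>n=k+1..N. f n)"
  using assms by (simp add: prod.atLeast_Suc_atMost)

text \<open>Multiplying by the factors in descending order of index lowers \<open>p N\<close> to
  \<open>p k\<close> one step at a time. This recovers the products in \<open>hs_point\<close> from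
  equations for single angles.\<close>

lemma prod_telescope_pred:
  fixes p c :: "nat \<Rightarrow> 'a::comm_monoid_mult"
  assumes "\<And>k. 2 \<le> k \<Longrightarrow> k \<le> N \<Longrightarrow> p (k - 1) = p k * c k"
    and "1 \<le> k" "k \<le> N"
  shows "p N * (\<Prod>n=k+1..N. c n) = p k"
  using \<open>k \<le> N\<close>
proof (induction rule: inc_induct)
  case base
  show ?case by simp
next
  case (step m)
  have "(\<Prod>n=m+1..N. c n) = c (m+1) * (\<Prod>n=Suc m+1..N. c n)"
    using step.hyps prod_atLeastAtMost_pred[of "m+1" N c] by simp
  then show ?case
    using step.hyps step.IH[symmetric] assms(1)[of "Suc m"] \<open>1 \<le> k\<close> by (simp add: mult_ac)
qed

section \<open>Coordinates described by one pair of equations per angle\<close>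

text \<open>Both sides have equal squares by upward induction on \<open>k\<close>. For
  \<open>k = 1\<close> the signed equality is immediate; for larger \<open>k\<close> both sides are
  nonnegative.\<close>

lemma partial_norm_hs_point:
  assumes "2 \<le> N"
    and "\<forall>k\<in>{3..N}. - (pi / 2) \<le> \<theta> k \<and> \<theta> k \<le> pi / 2"
    and "0 \<le> \<rho>" and x: "hs_point N \<rho> \<theta> = x"
    and "1 \<le> k" "k \<le> N"
  shows "partial_norm x k = \<rho> * (\<Prod>n=k+1..N. cos (\<theta> n))"
proof -
  define R where "R k = \<rho> * (\<Prod>n=k+1..N. cos (\<theta> n))" for k
  have x1: "x 1 = R 1"
    using assms(1) by (auto simp: x[symmetric] hs_point_def R_def numeral_2_eq_2)
  have xk: "x k = R k * sin (\<theta> k)" if "2 \<le> k" "k \<le> N" for k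
    using that by (auto simp: x[symmetric] hs_point_def R_def)
  have R_pred: "R (k - 1) = R k * cos (\<theta> k)" if "2 \<le> k" "k \<le> N" for k
    using that prod_atLeastAtMost_pred[of k N "\<lambda>n. cos (\<theta> n)"] by (simp add: R_def)
  have sq: "(R k)\<^sup>2 = (partial_norm x k)\<^sup>2"
    using assms(5,6)
  proof (induction rule: dec_induct)
    case base
    show ?case using x1 by simp
  next
    case (step n)
    \<comment> \<open>Inserting the Pythagorean identity splits the square as in
      \<open>partial_norm_square_pred\<close>.\<close>
    have "(R (Suc n))\<^sup>2 = (R (Suc n))\<^sup>2 * ((cos (\<theta> (Suc n)))\<^sup>2 + (sin (\<theta> (Suc n)))\<^sup>2)"
      by simp
    also have "\<dots> = (R n)\<^sup>2 + (x (Suc n))\<^sup>2"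
      using xk[of "Suc n"] R_pred[of "Suc n"] step.hyps step.prems
      by (simp add: power_mult_distrib algebra_simps del: sin_cos_squared_add sin_cos_squared_add2)
    also have "\<dots> = (partial_norm x (Suc n))\<^sup>2"
      using step partial_norm_square_pred[of "Suc n" x] by simp
    finally show ?case .
  qed
  show ?thesis
  proof (cases "k = 1")
    case True
    with x1 show ?thesis by (simp add: R_def)
  next
    case False
    then have "2 \<le> k" using assms(5) by simp
    \<comment> \<open>The indices start at \<open>k + 1\<close>, hence at 3 or later: only latitudes
      occur, and their cosines are nonnegative. The longitude, whose cosine may be negative, is
      absent.\<close>
    moreover have "0 \<le> (\<Prod>n=k+1..N. cos (\<theta> n))"
      using \<open>2 \<le> k\<close> assms(2) by (intro prod_nonneg ballI cos_ge_zero) auto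
    ultimately have "0 \<le> R k" "0 \<le> partial_norm x k"
      using assms(3) by (auto simp: R_def partial_norm_ge_2 sum_nonneg)
    with sq show ?thesis by (simp add: R_def)
  qed
qed

text \<open>Replaces the products over many angles by equations in which each angle occurs alone, so
  that existence and uniqueness can be settled angle by angle. One direction reads off the partial
  norms of \<open>hs_point\<close>, the other telescopes.\<close>

lemma is_hs_coords_iff:
  assumes "2 \<le> N" "x \<in> {1..N} \<rightarrow>\<^sub>E UNIV"
  shows "is_hs_coords N x (\<rho>, \<theta>) \<longleftrightarrow>
    \<theta> \<in> {2..N} \<rightarrow>\<^sub>E UNIV \<and> \<rho> = partial_norm x N \<and> 0 \<le> \<theta> 2 \<and> \<theta> 2 < 2 * pi \<and>
    (\<forall>k\<in>{3..N}. - (pi / 2) \<le> \<theta> k \<and> \<theta> k \<le> pi / 2) \<and>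
    (\<forall>k\<in>{2..N}. x k = partial_norm x k * sin (\<theta> k) \<and>
                 partial_norm x (k - 1) = partial_norm x k * cos (\<theta> k))"
    (is "_ \<longleftrightarrow> ?T \<and> ?\<rho> \<and> ?a \<and> ?b \<and> ?L \<and> ?E")
proof -
  have "hs_point N \<rho> \<theta> = x \<longleftrightarrow> ?E" if ?\<rho> ?L
  proof
    assume x: "hs_point N \<rho> \<theta> = x"
    have "0 \<le> \<rho>"
      using that assms(1) by (simp add: partial_norm_ge_2 sum_nonneg)
    note R = partial_norm_hs_point[OF assms(1) \<open>?L\<close> this x]
    show ?E
    proof
      fix k assume "k \<in> {2..N}"
      then have k: "2 \<le> k" "k \<le> N" by auto
      have "x k = \<rho> * sin (\<theta> k) * (\<Prod>n=k+1..N. cos (\<theta> n))"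
        using k by (simp add: x[symmetric] hs_point_def)
      then show "x k = partial_norm x k * sin (\<theta> k) \<and>
          partial_norm x (k - 1) = partial_norm x k * cos (\<theta> k)"
        using k R[of k] R[of "k - 1"] prod_atLeastAtMost_pred[of k N "\<lambda>n. cos (\<theta> n)"]
        by (simp add: mult_ac)
    qed
  next
    assume E: ?E
    have tel: "partial_norm x N * (\<Prod>n=k+1..N. cos (\<theta> n)) = partial_norm x k" if "1 \<le> k" "k \<le> N" for k
      using that E by (intro prod_telescope_pred) auto
    show "hs_point N \<rho> \<theta> = x"
    proof
      fix k
      consider "k \<notin> {1..N}" | "k = 1" | "2 \<le> k" "k \<le> N"
        by fastforce
      then show "hs_point N \<rho> \<theta> k = x k"
      proof cases
        case 1
        then show ?thesis
          using assms(2) by (auto simp: hs_point_def PiE_def extensional_def)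
      next
        case 2
        then show ?thesis
          using \<open>?\<rho>\<close> tel[of 1] assms(1) by (simp add: hs_point_def numeral_2_eq_2)
      next
        case 3
        have "hs_point N \<rho> \<theta> k = partial_norm x N * (\<Prod>n=k+1..N. cos (\<theta> n)) * sin (\<theta> k)"
          using 3 \<open>?\<rho>\<close> by (simp add: hs_point_def)
        then show ?thesis
          using 3 E tel[of k] by simp
      qed
    qed
  qed
  then show ?thesis
    using assms(1) by (auto simp: is_hs_coords_def partial_norm_ge_2)
qed

section \<open>Existence and uniqueness of the coordinates\<close>

text \<open>For each \<open>k\<close> the required cosine and sine are
  \<open>?p (k - 1) / ?p k\<close> and \<open>x k / ?p k\<close>, which form a point of the unit
  circle by the recurrence for squared partial norms.\<close>

lemma is_hs_coords_exists:
  assumes N: "2 \<le> N" "x \<in> {1..N} \<rightarrow>\<^sub>E UNIV" and nz: "(x 1, x 2) \<noteq> (0, 0)"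
  shows "\<exists>\<theta>. is_hs_coords N x (partial_norm x N, \<theta>)"
proof -
  let ?p = "partial_norm x"
  note pos = partial_norm_pos[of x, OF nz]
  have unit: "(?p (k - 1) / ?p k)\<^sup>2 + (x k / ?p k)\<^sup>2 = 1" if "2 \<le> k" for k
    unfolding power_divide add_divide_distrib[symmetric]
      partial_norm_square_pred[OF that, of x, symmetric]
    using pos[OF that] by simp
  obtain t where t: "0 \<le> t" "t < 2 * pi" "?p 1 / ?p 2 = cos t" "x 2 / ?p 2 = sin t"
    using sincos_total_2pi[OF unit[of 2]] by auto
  \<comment> \<open>The arcsine yields nonnegative cosines, as the latitudes require; the longitude
    needs an angle from the full circle. The restriction to \<open>{2..N}\<close> provides
    extensionality.\<close>
  define \<theta> where "\<theta> = (\<lambda>k\<in>{2..N}. if k = 2 then t else arcsin (x k / ?p k))"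
  have bounds: "-1 \<le> x k / ?p k \<and> x k / ?p k \<le> 1" if "2 \<le> k" for k
  proof -
    have "(x k / ?p k)\<^sup>2 \<le> 1"
      using unit[OF that] zero_le_power2[of "?p (k - 1) / ?p k"] by linarith
    then have "\<bar>x k / ?p k\<bar> \<le> 1"
      by (simp only: abs_square_le_1)
    then show ?thesis by linarith
  qed
  have "sin (\<theta> k) = x k / ?p k \<and> cos (\<theta> k) = ?p (k - 1) / ?p k" if k: "2 \<le> k" "k \<le> N" for k
  proof (cases "k = 2")
    case True
    then show ?thesis using t k by (simp add: \<theta>_def)
  next
    case False
    \<comment> \<open>Here \<open>k - 1\<close> is at least 2, so the cosine ratio is positive and
      equals the nonnegative root in the formula for the cosine of an arcsine.\<close>
    have "0 < ?p k" "0 < ?p (k - 1)"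
      using k False by (auto intro!: pos simp del: One_nat_def)
    then have "0 \<le> ?p (k - 1) / ?p k"
      by simp
    then have "sqrt (1 - (x k / ?p k)\<^sup>2) = ?p (k - 1) / ?p k"
      using unit[of k] k by (intro real_sqrt_unique) auto
    then show ?thesis
      using False k bounds[of k] by (simp add: \<theta>_def cos_arcsin)
  qed
  then have "x k = ?p k * sin (\<theta> k) \<and> ?p (k - 1) = ?p k * cos (\<theta> k)" if "k \<in> {2..N}" for k
    using that pos[of k] by simp
  then have "\<forall>k\<in>{2..N}. x k = ?p k * sin (\<theta> k) \<and> ?p (k - 1) = ?p k * cos (\<theta> k)"
    by blast
  moreover have "\<forall>k\<in>{3..N}. - (pi / 2) \<le> \<theta> k \<and> \<theta> k \<le> pi / 2"
    using bounds arcsin_lbound arcsin_ubound by (auto simp: \<theta>_def)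
  moreover have "\<theta> \<in> {2..N} \<rightarrow>\<^sub>E UNIV" "\<theta> 2 = t"
    using N by (auto simp: \<theta>_def)
  ultimately show ?thesis
    using t by (subst is_hs_coords_iff[OF N]) auto
qed

text \<open>Cancelling the positive partial norms determines the sine and cosine of every angle; the
  prescribed ranges then determine the angle itself.\<close>

lemma is_hs_coords_unique:
  assumes N: "2 \<le> N" "x \<in> {1..N} \<rightarrow>\<^sub>E UNIV" and nz: "(x 1, x 2) \<noteq> (0, 0)"
    and "is_hs_coords N x (\<rho>, \<theta>)" "is_hs_coords N x (\<rho>', \<theta>')"
  shows "(\<rho>, \<theta>) = (\<rho>', \<theta>')"
proof -
  let ?p = "partial_norm x"
  note c = assms(4)[unfolded is_hs_coords_iff[OF N]] and c' = assms(5)[unfolded is_hs_coords_iff[OF N]]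
  have sc: "sin (\<theta> k) = sin (\<theta>' k) \<and> cos (\<theta> k) = cos (\<theta>' k)" if "k \<in> {2..N}" for k
  proof -
    have "?p k * sin (\<theta> k) = ?p k * sin (\<theta>' k)" "?p k * cos (\<theta> k) = ?p k * cos (\<theta>' k)"
      using c c' that by metis+
    then show ?thesis
      using partial_norm_pos[of x k, OF nz] that by simp
  qed
  have "\<theta> k = \<theta>' k" if k: "k \<in> {2..N}" for k
  proof (cases "k = 2")
    case True
    obtain n :: int where n: "\<theta> 2 = \<theta>' 2 + 2 * pi * n"
      using sc[OF k] True sin_cos_eq_iff[of "\<theta> 2" "\<theta>' 2"] by auto
    have "0 \<le> \<theta> 2" "\<theta> 2 < 2 * pi" "0 \<le> \<theta>' 2" "\<theta>' 2 < 2 * pi"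
      using c c' by blast+
    \<comment> \<open>The two longitudes differ by \<open>n\<close> full turns but both lie in a
      half-open interval of length one turn, which forces \<open>n = 0\<close>.\<close>
    with n have "2 * pi * n < 2 * pi * 1" "2 * pi * (-1) < 2 * pi * n"
      by linarith+
    then have "real_of_int n < 1" "-1 < real_of_int n"
      by (simp_all only: mult_less_cancel_left_pos[of "2 * pi"] pi_gt_zero mult_pos_pos zero_less_numeral)
    then have "n = 0" by linarith
    with n True show ?thesis by simp
  next
    case False
    then have "k \<in> {3..N}" using k by auto
    then have "- (pi / 2) \<le> \<theta> k" "\<theta> k \<le> pi / 2" "- (pi / 2) \<le> \<theta>' k" "\<theta>' k \<le> pi / 2"
      using c c' by blast+
    then show ?thesis
      using sc[OF k] by (blast intro: sin_inj_pi)
  qed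
  moreover have "\<theta> \<in> {2..N} \<rightarrow>\<^sub>E UNIV" "\<theta>' \<in> {2..N} \<rightarrow>\<^sub>E UNIV" "\<rho> = \<rho>'"
    using c c' by blast+
  ultimately show ?thesis
    using PiE_ext[of \<theta> _ _ \<theta>'] by blast
qed

text \<open>Existence and uniqueness let the definite description in \<open>hs_coords\<close> be
  evaluated.\<close>

lemma hs_coords_partial_norm:
  assumes N: "2 \<le> N" "x \<in> {1..N} \<rightarrow>\<^sub>E UNIV" and nz: "(x 1, x 2) \<noteq> (0, 0)"
  obtains \<theta> where "hs_coords N x = (partial_norm x N, \<theta>)"
    and "\<And>k. 2 \<le> k \<Longrightarrow> k \<le> N \<Longrightarrow> x k = partial_norm x k * sin (\<theta> k)"
    and "\<And>k. 2 \<le> k \<Longrightarrow> k \<le> N \<Longrightarrow> partial_norm x (k - 1) = partial_norm x k * cos (\<theta> k)"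
proof -
  obtain \<theta> where \<theta>: "is_hs_coords N x (partial_norm x N, \<theta>)"
    using is_hs_coords_exists[OF assms] by blast
  have "hs_coords N x = (partial_norm x N, \<theta>)"
    unfolding hs_coords_def
  proof (rule the_equality, rule \<theta>)
    fix c assume "is_hs_coords N x c"
    then show "c = (partial_norm x N, \<theta>)"
      using is_hs_coords_unique[OF assms _ \<theta>] by (cases c) blast
  qed
  with \<theta> that show thesis
    unfolding is_hs_coords_iff[OF N] by auto
qed

section \<open>The product formulas\<close>

lemma hs_mult_partial_norm:
  assumes N: "2 \<le> N"
    and x: "x \<in> {1..N} \<rightarrow>\<^sub>E UNIV" "(x 1, x 2) \<noteq> (0, 0)"
    and x': "x' \<in> {1..N} \<rightarrow>\<^sub>E UNIV" "(x' 1, x' 2) \<noteq> (0, 0)"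
  defines "p \<equiv> partial_norm x" and "p' \<equiv> partial_norm x'"
  shows "hs_mult N x x' 1 = (x 1 * x' 1 - x 2 * x' 2)
           * (\<Prod>n=3..N. 1 - x n * x' n / (p (n - 1) * p' (n - 1)))"
    and "\<And>k. 2 \<le> k \<Longrightarrow> k \<le> N \<Longrightarrow> hs_mult N x x' k = (x k * p' (k - 1) + x' k * p (k - 1))
           * (\<Prod>n=k+1..N. 1 - x n * x' n / (p (n - 1) * p' (n - 1)))"
proof -
  obtain \<theta> where \<theta>: "hs_coords N x = (p N, \<theta>)"
    and s: "\<And>k. 2 \<le> k \<Longrightarrow> k \<le> N \<Longrightarrow> x k = p k * sin (\<theta> k)"
    and c: "\<And>k. 2 \<le> k \<Longrightarrow> k \<le> N \<Longrightarrow> p (k - 1) = p k * cos (\<theta> k)"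
    unfolding p_def using hs_coords_partial_norm[OF N x] by blast
  obtain \<theta>' where \<theta>': "hs_coords N x' = (p' N, \<theta>')"
    and s': "\<And>k. 2 \<le> k \<Longrightarrow> k \<le> N \<Longrightarrow> x' k = p' k * sin (\<theta>' k)"
    and c': "\<And>k. 2 \<le> k \<Longrightarrow> k \<le> N \<Longrightarrow> p' (k - 1) = p' k * cos (\<theta>' k)"
    unfolding p'_def using hs_coords_partial_norm[OF N x'] by blast
  define C where "C n = cos (\<theta> n + \<theta>' n)" for n
  define D where "D n = 1 - x n * x' n / (p (n - 1) * p' (n - 1))" for n
  have pos: "0 < p n" "0 < p' n" if "2 \<le> n" for n
    using that x(2) x'(2) by (simp_all add: p_def p'_def partial_norm_pos)
  have cos_add_scaled: "p n * p' n * C n = p (n - 1) * p' (n - 1) - x n * x' n" if "2 \<le> n" "n \<le> N" for n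
    using s[OF that] c[OF that] s'[OF that] c'[OF that]
    by (simp add: C_def cos_add algebra_simps)
  \<comment> \<open>From 3 on, the divisors in \<open>D n\<close> are partial norms of index at
    least 2 and hence nonzero. For \<open>n = 2\<close> they would be \<open>x 1\<close> and
    \<open>x' 1\<close>, which may vanish.\<close>
  have D_step: "p n * p' n * C n = p (n - 1) * p' (n - 1) * D n" if "3 \<le> n" "n \<le> N" for n
    proof -
    have "0 < p (n - 1)" "0 < p' (n - 1)"
      using that by (intro pos; simp)+
    then show ?thesis
      using cos_add_scaled[of n] that by (simp add: D_def right_diff_distrib)
  qed
  \<comment> \<open>Descending from \<open>N\<close>, each step trades a factor \<open>C n\<close>
    for \<open>D n\<close> and lowers the index of both partial norms. It stops at
    \<open>k = 2\<close>, the last index that \<open>D_step\<close> reaches.\<close>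
  have tel: "p N * p' N * (\<Prod>n=k+1..N. C n) = p k * p' k * (\<Prod>n=k+1..N. D n)" if "2 \<le> k" "k \<le> N" for k
    using that(2)
  proof (induction rule: inc_induct)
    case base
    show ?case by simp
  next
    case (step m)
    have split: "(\<Prod>n=m+1..N. f n) = f (Suc m) * (\<Prod>n=Suc m+1..N. f n)" for f :: "nat \<Rightarrow> real"
      using step.hyps prod_atLeastAtMost_pred[of "m+1" N f] by simp
    have "p N * p' N * (\<Prod>n=m+1..N. C n) = (p N * p' N * (\<Prod>n=Suc m+1..N. C n)) * C (Suc m)"
      by (simp only: split mult_ac)
    also have "\<dots> = (p (Suc m) * p' (Suc m) * C (Suc m)) * (\<Prod>n=Suc m+1..N. D n)"
      by (subst step.IH) (simp only: mult_ac)
    also have "\<dots> = p m * p' m * (\<Prod>n=m+1..N. D n)"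
      using D_step[of "Suc m"] step.hyps that(1) split[of D] by (simp add: mult_ac)
    finally show ?case .
  qed
  have mult: "hs_mult N x x' = hs_point N (p N * p' N) (\<lambda>n. \<theta> n + \<theta>' n)"
    by (simp add: hs_mult_def \<theta> \<theta>')
  show "hs_mult N x x' k = (x k * p' (k - 1) + x' k * p (k - 1)) * (\<Prod>n=k+1..N. D n)"
    if k: "2 \<le> k" "k \<le> N" for k
  proof -
    have "hs_mult N x x' k = sin (\<theta> k + \<theta>' k) * (p N * p' N * (\<Prod>n=k+1..N. C n))"
      using k by (simp add: mult hs_point_def C_def)
    also have "\<dots> = (p k * p' k * sin (\<theta> k + \<theta>' k)) * (\<Prod>n=k+1..N. D n)"
      by (subst tel[OF k]) (simp only: mult_ac)
    also have "p k * p' k * sin (\<theta> k + \<theta>' k) = x k * p' (k - 1) + x' k * p (k - 1)"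
      using s[OF k] c[OF k] s'[OF k] c'[OF k] by (simp add: sin_add algebra_simps)
    finally show ?thesis .
  qed
  \<comment> \<open>The longitude factor \<open>C 2\<close> is split off and evaluated by the
    addition theorem without factoring; it gives the bracket
    \<open>x 1 * x' 1 - x 2 * x' 2\<close>.\<close>
  have "hs_mult N x x' 1 = C 2 * (p N * p' N * (\<Prod>n=2+1..N. C n))"
    using N prod_atLeastAtMost_pred[of 2 N C] by (simp add: mult hs_point_def C_def)
  also have "\<dots> = (p 2 * p' 2 * C 2) * (\<Prod>n=3..N. D n)"
    using tel[of 2] N by simp
  also have "p 2 * p' 2 * C 2 = x 1 * x' 1 - x 2 * x' 2"
    using cos_add_scaled[of 2] N by (simp add: p_def p'_def)
  finally show "hs_mult N x x' 1 = (x 1 * x' 1 - x 2 * x' 2) * (\<Prod>n=3..N. D n)" .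
qed

theorem mainTheorem2:
  fixes N :: nat and x x' x'' r r' :: "nat \<Rightarrow> real"
  assumes "N \<ge> 3"
    and "x \<in> {1..N} \<rightarrow>\<^sub>E UNIV" and "x' \<in> {1..N} \<rightarrow>\<^sub>E UNIV"
    and "(x 1, x 2) \<noteq> (0, 0)" and "(x' 1, x' 2) \<noteq> (0, 0)"
    and "x'' = hs_mult N x x'"
    and "r 1 = x 1" and "\<And>n. 2 \<le> n \<Longrightarrow> n \<le> N \<Longrightarrow> r n = sqrt (\<Sum>k=1..n. (x k)\<^sup>2)"
    and "r' 1 = x' 1" and "\<And>n. 2 \<le> n \<Longrightarrow> n \<le> N \<Longrightarrow> r' n = sqrt (\<Sum>k=1..n. (x' k)\<^sup>2)"
  shows "x'' 1 = (x 1 * x' 1 - x 2 * x' 2)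
           * (\<Prod>n=3..N. 1 - x n * x' n / (r (n - 1) * r' (n - 1)))
    \<and> (\<forall>k. 2 \<le> k \<and> k \<le> N \<longrightarrow>
         x'' k = (x k * r' (k - 1) + x' k * r (k - 1))
           * (\<Prod>n=k+1..N. 1 - x n * x' n / (r (n - 1) * r' (n - 1))))
    \<and> x'' 2 = (x 1 * x' 2 + x 2 * x' 1)
           * (\<Prod>n=3..N. 1 - x n * x' n / (r (n - 1) * r' (n - 1)))
    \<and> x'' N = x N * r' (N - 1) + x' N * r (N - 1)"
proof -
  have r: "r n = partial_norm x n" "r' n = partial_norm x' n" if "1 \<le> n" "n \<le> N" for n
    using that assms(7-10) by (cases "n = 1"; simp add: partial_norm_ge_2)+
  \<comment> \<open>The assumptions fix \<open>r\<close> and \<open>r'\<close> only on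
    \<open>{1..N}\<close>; every index \<open>n - 1\<close> in these products lies in that
    range.\<close>
  have prod_eq: "(\<Prod>n=m..N. 1 - x n * x' n / (r (n - 1) * r' (n - 1)))
      = (\<Prod>n=m..N. 1 - x n * x' n / (partial_norm x (n - 1) * partial_norm x' (n - 1)))"
    if "3 \<le> m" for m
    using that by (intro prod.cong) (auto simp: r)
  have N: "2 \<le> N" using assms(1) by simp
  note formulas = hs_mult_partial_norm[OF N assms(2,4,3,5), folded assms(6)]
  have k: "x'' k = (x k * r' (k - 1) + x' k * r (k - 1))
      * (\<Prod>n=k+1..N. 1 - x n * x' n / (r (n - 1) * r' (n - 1)))" if "2 \<le> k" "k \<le> N" for k
    using formulas(2)[OF that] that prod_eq[of "k + 1"] by (simp add: r)
  \<comment> \<open>For \<open>k = 2\<close> the signed values \<open>r 1 = x 1\<close> and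
    \<open>r' 1 = x' 1\<close> enter; for \<open>k = N\<close> the product is empty.\<close>
  show ?thesis
    using formulas(1) prod_eq[of 3] k k[of 2] k[of N] assms(1,7,9) by simp
qed

end
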